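(* Let $p$ be an odd prime, let $m \geq 1$ and let $a_1, a_2, \ldots, a_m \in \mathbb{Z}_p$. The quadratic form $\sum_{i=1}^{m} a_i X_i^2$ is universal over $M_2(\mathbb{Z}_p)$ if and only if at least two of the numbers $a_1, a_2, \ldots, a_m$ (counted by index) are units in $\mathbb{Z}_p$.
   Context: $\mathbb{Z}_p$ is the ring of $p$-adic integers and $M_2(R)$ is the ring of $2 \times 2$ matrices over $R$. A form $\sum_{i=1}^m a_i X_i^2$ with $a_i \in R$ is universal over $M_n(R)$ if for every $A \in M_n(R)$ there exist $X_1, \ldots, X_m \in M_n(R)$ with $A = \sum_{i=1}^m a_i X_i^2$. *)

theory Defs
  imports "HOL-Algebra.Module" "HOL-Computational_Algebra.Primes"
begin

text \<open>
  The ring of \<open>p\<close>-adic integers is the inverse limit of the rings \<open>\<int>/p\<^sup>n\<int>\<close>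
  along the reduction maps: a \<open>p\<close>-adic integer is the sequence of its residues modulo
  \<open>p\<^sup>n\<close>, each represented by an integer in \<open>{0..<p\<^sup>n}\<close>.  The term with index \<open>0\<close>
  lives in the zero ring and is always \<open>0\<close>.
\<close>

definition padic_int_ring :: "nat \<Rightarrow> (nat \<Rightarrow> int) ring" where
  "padic_int_ring p =
    \<lparr>carrier = {x. \<forall>n. x n \<in> {0..<int p ^ n} \<and> x (Suc n) mod int p ^ n = x n},
     monoid.mult = (\<lambda>x y n. (x n * y n) mod int p ^ n),
     one = (\<lambda>n. 1 mod int p ^ n),
     zero = (\<lambda>n. 0),
     add = (\<lambda>x y n. (x n + y n) mod int p ^ n)\<rparr>"

text \<open>
  \<open>M\<^sub>n(R)\<close>, with rows and columns indexed by \<open>{..<n}\<close>.  Matrices are extensional functions,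
  so that equality of matrices is equality of their entries.  The record type of modules
  provides the ring operations together with the scalar multiplication by elements of \<open>R\<close>.
\<close>

definition matrix_ring ::
    "('a, 'r) ring_scheme \<Rightarrow> nat \<Rightarrow> ('a, nat \<times> nat \<Rightarrow> 'a) module" where
  "matrix_ring R n =
    \<lparr>carrier = ({..<n} \<times> {..<n}) \<rightarrow>\<^sub>E carrier R,
     monoid.mult = (\<lambda>A B. \<lambda>(i, j) \<in> {..<n} \<times> {..<n}.
               \<Oplus>\<^bsub>R\<^esub>k\<in>{..<n}. A (i, k) \<otimes>\<^bsub>R\<^esub> B (k, j)),
     one = (\<lambda>(i, j) \<in> {..<n} \<times> {..<n}. if i = j then \<one>\<^bsub>R\<^esub> else \<zero>\<^bsub>R\<^esub>),
     zero = (\<lambda>(i, j) \<in> {..<n} \<times> {..<n}. \<zero>\<^bsub>R\<^esub>),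
     add = (\<lambda>A B. \<lambda>(i, j) \<in> {..<n} \<times> {..<n}. A (i, j) \<oplus>\<^bsub>R\<^esub> B (i, j)),
     smult = (\<lambda>c A. \<lambda>(i, j) \<in> {..<n} \<times> {..<n}. c \<otimes>\<^bsub>R\<^esub> A (i, j))\<rparr>"

definition universal_over_matrices ::
    "('a, 'r) ring_scheme \<Rightarrow> nat \<Rightarrow> nat \<Rightarrow> (nat \<Rightarrow> 'a) \<Rightarrow> bool" where
  "universal_over_matrices R n m a \<longleftrightarrow>
    (\<forall>A \<in> carrier (matrix_ring R n).
      \<exists>X \<in> {1..m} \<rightarrow> carrier (matrix_ring R n).
        A = (\<Oplus>\<^bsub>matrix_ring R n\<^esub>i\<in>{1..m}.
               a i \<odot>\<^bsub>matrix_ring R n\<^esub> (X i [^]\<^bsub>matrix_ring R n\<^esub> (2::nat))))"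


lemma padic_int_cring:
  assumes "p > 0"
  shows "cring (padic_int_ring p)"
proof -
  define Z where "Z = padic_int_ring p"
  have car: "carrier Z = {x. \<forall>n. x n \<in> {0..<int p ^ n} \<and> x (Suc n) mod int p ^ n = x n}"
    and mu: "\<And>x y. x \<otimes>\<^bsub>Z\<^esub> y = (\<lambda>n. (x n * y n) mod int p ^ n)"
    and ad: "\<And>x y. x \<oplus>\<^bsub>Z\<^esub> y = (\<lambda>n. (x n + y n) mod int p ^ n)"
    and on: "\<one>\<^bsub>Z\<^esub> = (\<lambda>n. 1 mod int p ^ n)"
    and ze: "\<zero>\<^bsub>Z\<^esub> = (\<lambda>n. 0)"
    by (simp_all add: Z_def padic_int_ring_def)
  have pos: "int p ^ n > 0" for n using assms by simp
  have mm: "(k mod int p ^ Suc n) mod int p ^ n = k mod int p ^ n" for k :: int and n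
    by (rule mod_mod_cancel) simp
  have in_car: "(\<lambda>n. f n mod int p ^ n) \<in> carrier Z"
    if "\<And>n. f (Suc n) mod int p ^ n = f n mod int p ^ n" for f :: "nat \<Rightarrow> int"
    using that pos mm by (auto simp: car simp del: power_Suc)
  have coh: "x (Suc n) mod int p ^ n = x n" if "x \<in> carrier Z" for x n
    using that by (auto simp: car)
  have fix_mod: "x n mod int p ^ n = x n" if "x \<in> carrier Z" for x n
    using that by (auto simp: car)
  have madd: "x \<oplus>\<^bsub>Z\<^esub> y \<in> carrier Z" if "x \<in> carrier Z" "y \<in> carrier Z" for x y
    unfolding ad by (rule in_car) (metis mod_add_eq coh that)
  have mmul: "x \<otimes>\<^bsub>Z\<^esub> y \<in> carrier Z" if "x \<in> carrier Z" "y \<in> carrier Z" for x y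
    unfolding mu by (rule in_car) (metis mod_mult_eq coh that)
  have "cring Z"
  proof (rule cringI)
    show "abelian_group Z"
    proof (rule abelian_groupI)
      fix x assume x: "x \<in> carrier Z"
      have "(\<lambda>n. (- x n) mod int p ^ n) \<in> carrier Z"
        by (rule in_car) (metis mod_minus_eq coh x)
      moreover have "(\<lambda>n. (- x n) mod int p ^ n) \<oplus>\<^bsub>Z\<^esub> x = \<zero>\<^bsub>Z\<^esub>"
        by (simp add: ad ze mod_simps)
      ultimately show "\<exists>y\<in>carrier Z. y \<oplus>\<^bsub>Z\<^esub> x = \<zero>\<^bsub>Z\<^esub>" by blast
    next
      show "\<zero>\<^bsub>Z\<^esub> \<in> carrier Z" using assms by (simp add: car ze)
    qed (auto simp: ad ze mod_simps madd[unfolded ad] fix_mod algebra_simps)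
  next
    show "Group.comm_monoid Z"
    proof (rule comm_monoidI)
      show "\<one>\<^bsub>Z\<^esub> \<in> carrier Z" unfolding on by (rule in_car) simp
    qed (auto simp: mu on mod_simps mmul[unfolded mu] fix_mod algebra_simps)
  next
    fix x y z
    show "(x \<oplus>\<^bsub>Z\<^esub> y) \<otimes>\<^bsub>Z\<^esub> z = x \<otimes>\<^bsub>Z\<^esub> z \<oplus>\<^bsub>Z\<^esub> y \<otimes>\<^bsub>Z\<^esub> z"
      by (simp add: mu ad mod_simps algebra_simps)
  qed
  then show ?thesis by (simp add: Z_def)
qed

lemma matrix_ring_abelian_group:
  assumes "ring R"
  shows "abelian_group (matrix_ring R n)"
proof -
  interpret ring R by fact
  define M where "M = matrix_ring R n"
  have car: "carrier M = ({..<n} \<times> {..<n}) \<rightarrow>\<^sub>E carrier R"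
    and ad: "\<And>A B. A \<oplus>\<^bsub>M\<^esub> B = (\<lambda>(i, j) \<in> {..<n} \<times> {..<n}. A (i, j) \<oplus>\<^bsub>R\<^esub> B (i, j))"
    and ze: "\<zero>\<^bsub>M\<^esub> = (\<lambda>(i, j) \<in> {..<n} \<times> {..<n}. \<zero>\<^bsub>R\<^esub>)"
    by (simp_all add: M_def matrix_ring_def)
  have el: "A (i, j) \<in> carrier R" if "A \<in> carrier M" "i < n" "j < n" for A i j
    using that by (auto simp: car PiE_iff)
  have eqI: "A = B" if "A \<in> extensional ({..<n} \<times> {..<n})" "B \<in> extensional ({..<n} \<times> {..<n})"
    "\<And>i j. i < n \<Longrightarrow> j < n \<Longrightarrow> A (i, j) = B (i, j)" for A B :: "nat \<times> nat \<Rightarrow> 'a"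
    by (rule extensionalityI[OF that(1,2)]) (auto intro: that(3))
  have ex: "A \<in> extensional ({..<n} \<times> {..<n})" if "A \<in> carrier M" for A
    using that by (simp add: car PiE_iff)
  have adc: "A \<oplus>\<^bsub>M\<^esub> B \<in> carrier M" if "A \<in> carrier M" "B \<in> carrier M" for A B
    using el[OF that(1)] el[OF that(2)] by (auto simp: car ad)
  have zec: "\<zero>\<^bsub>M\<^esub> \<in> carrier M" by (auto simp: car ze)
  have "abelian_group M"
  proof (rule abelian_groupI)
    fix A assume A: "A \<in> carrier M"
    define B where "B = (\<lambda>(i, j) \<in> {..<n} \<times> {..<n}. \<ominus>\<^bsub>R\<^esub> A (i, j))"
    have "B \<in> carrier M" using el[OF A] by (auto simp: car B_def)
    moreover have "B \<oplus>\<^bsub>M\<^esub> A = \<zero>\<^bsub>M\<^esub>"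
      by (rule eqI) (auto simp: ad ze B_def el[OF A] l_neg)
    ultimately show "\<exists>B\<in>carrier M. B \<oplus>\<^bsub>M\<^esub> A = \<zero>\<^bsub>M\<^esub>" by blast
  next
    fix A B C assume "A \<in> carrier M" "B \<in> carrier M" "C \<in> carrier M"
    then show "A \<oplus>\<^bsub>M\<^esub> B \<oplus>\<^bsub>M\<^esub> C = A \<oplus>\<^bsub>M\<^esub> (B \<oplus>\<^bsub>M\<^esub> C)"
      by (intro eqI) (auto simp: ad el a_assoc)
  next
    fix A B assume "A \<in> carrier M" "B \<in> carrier M"
    then show "A \<oplus>\<^bsub>M\<^esub> B = B \<oplus>\<^bsub>M\<^esub> A"
      by (intro eqI) (auto simp: ad el a_comm)
  next
    fix A assume A: "A \<in> carrier M"
    then show "\<zero>\<^bsub>M\<^esub> \<oplus>\<^bsub>M\<^esub> A = A"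
      by (intro eqI ex adc zec) (auto simp: ad ze el)
  qed (auto simp: adc zec)
  then show ?thesis by (simp add: M_def)
qed

end

theory Submission
  imports Defs "HOL-Number_Theory.Cong"
begin

text \<open>Sufficiency works over any commutative ring in which 2 is invertible: given units u and
  v, every 2 by 2 matrix A has the form u X^2 + v Y^2. By Cayley-Hamilton, a matrix X of trace 1
  satisfies X^2 = X - det X, so X can be given the off-diagonal entries of A / u, and the trace
  condition still leaves one free diagonal parameter. It is chosen so that A / u - X^2 is a scalar
  matrix, which is absorbed by a Y of trace 0. This is \<open>matrix2_two_squares\<close>; setting
  the other variables to 0 gives \<open>universal_over_matrices2I\<close>. For odd p, 2 is a unit of
  the p-adic integers.

  Necessity is an obstruction modulo p. A p-adic integer with nonzero residue modulo p is a unit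
  (\<open>padic_UnitsI\<close>), so with at most one unit coefficient the form reduces modulo p to a
  single term c X^2. This cannot equal the nilpotent matrix unit with 1 in the upper right corner: X
  would be nilpotent, so X^2 = 0 in size 2
  (\<open>scaled_square_not_nilpotent_mod_prime\<close>).\<close>

section \<open>Residues and units of p-adic integers\<close>

lemma padic_carrier:
  "x \<in> carrier (padic_int_ring p) \<longleftrightarrow>
    (\<forall>n. x n \<in> {0..<int p ^ n} \<and> x (Suc n) mod int p ^ n = x n)"
  by (simp add: padic_int_ring_def)

lemma padic_mult: "x \<otimes>\<^bsub>padic_int_ring p\<^esub> y = (\<lambda>n. (x n * y n) mod int p ^ n)"
  and padic_add: "x \<oplus>\<^bsub>padic_int_ring p\<^esub> y = (\<lambda>n. (x n + y n) mod int p ^ n)"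
  and padic_one: "\<one>\<^bsub>padic_int_ring p\<^esub> = (\<lambda>n. 1 mod int p ^ n)"
  and padic_zero: "\<zero>\<^bsub>padic_int_ring p\<^esub> = (\<lambda>n. 0)"
  by (simp_all add: padic_int_ring_def)

lemma padic_mod_self: "x \<in> carrier (padic_int_ring p) \<Longrightarrow> x n mod int p ^ n = x n"
  by (simp add: padic_carrier)

lemma padic_finsum:
  assumes "p > 0" "finite I" "f \<in> I \<rightarrow> carrier (padic_int_ring p)"
  shows "(\<Oplus>\<^bsub>padic_int_ring p\<^esub>i\<in>I. f i) n = (\<Sum>i\<in>I. f i n) mod int p ^ n"
proof -
  interpret cring "padic_int_ring p" using assms(1) by (rule padic_int_cring)
  from assms(2,3) show ?thesis
    by (induction I rule: finite_induct)
      (simp_all add: padic_zero padic_add finsum_insert Pi_iff mod_simps)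
qed

text \<open>Compatibility of residues descends one level at a time and stops at level 1; level 0 is
  the zero ring and sees nothing of the residue modulo p.\<close>

lemma padic_mod_1:
  assumes "x \<in> carrier (padic_int_ring p)" "n > 0"
  shows "x n mod int p = x 1"
  using assms(2)
proof (induction n rule: nat_induct_non_zero)
  case 1
  show ?case using padic_mod_self[OF assms(1), of 1] by simp
next
  case (Suc n)
  have "x (Suc n) mod int p = x (Suc n) mod int p ^ n mod int p"
    using Suc.hyps by (simp add: mod_mod_cancel dvd_power)
  also have "\<dots> = x 1" using assms(1) Suc.IH by (simp add: padic_carrier)
  finally show ?case .
qed

text \<open>A nonzero residue modulo p makes every residue of \<open>x\<close> coprime to its
  modulus, so \<open>x\<close> can be inverted at each level; uniqueness of inverses glues these
  into one p-adic integer.\<close>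

lemma padic_UnitsI:
  assumes "prime p" "x \<in> carrier (padic_int_ring p)" "x 1 \<noteq> 0"
  shows "x \<in> Units (padic_int_ring p)"
proof -
  have p0: "p > 0" using assms(1) by (rule prime_gt_0_nat)
  interpret cring "padic_int_ring p" using p0 by (rule padic_int_cring)
  have coh: "x (Suc n) mod int p ^ n = x n" for n using assms(2) by (simp add: padic_carrier)
  have cop: "coprime (x n) (int p ^ n)" for n
  proof (cases "n = 0")
    case False
    then have "\<not> int p dvd x n"
      using padic_mod_1[OF assms(2), of n] assms(3) by (simp add: dvd_eq_mod_eq_0)
    then show ?thesis
      using assms(1) by (simp add: prime_imp_coprime coprime_commute)
  qed simp
  have "\<exists>z. [x n * z = 1] (mod int p ^ n)" for n
    using cong_solve_coprime_int[OF cop] .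
  then obtain z where z: "\<And>n. [x n * z n = 1] (mod int p ^ n)" by metis
  define y where "y n = z n mod int p ^ n" for n
  have y: "[x n * y n = 1] (mod int p ^ n)" for n
    using z by (simp add: y_def cong_def mod_simps)
  \<comment> \<open>Both sides invert \<open>x n\<close> modulo p^n, and \<open>x n\<close> can be
    cancelled there.\<close>
  have "y (Suc n) mod int p ^ n = y n" for n
  proof -
    have "[x (Suc n) * y (Suc n) = 1] (mod int p ^ n)"
      using y[of "Suc n"] by (rule cong_dvd_modulus) (simp add: le_imp_power_dvd)
    then have "[x n * y (Suc n) = 1] (mod int p ^ n)"
      by (metis cong_def coh mod_mult_left_eq)
    then have "[x n * y (Suc n) = x n * y n] (mod int p ^ n)"
      using y cong_sym cong_trans by blast
    then show ?thesis
      using cop[of n] by (simp only: cong_mult_lcancel) (simp add: cong_def y_def)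
  qed
  then have "y \<in> carrier (padic_int_ring p)" using p0 by (simp add: padic_carrier y_def)
  moreover have "x \<otimes>\<^bsub>padic_int_ring p\<^esub> y = \<one>\<^bsub>padic_int_ring p\<^esub>"
    using y by (simp add: padic_mult padic_one cong_def)
  ultimately show ?thesis
    using assms(2) m_comm unfolding Units_def by force
qed

section \<open>Entrywise description of the matrix operations\<close>

lemma matrix_carrier: "carrier (matrix_ring R n) = ({..<n} \<times> {..<n}) \<rightarrow>\<^sub>E carrier R"
  by (simp add: matrix_ring_def)

lemma matrix_entry_closed:
  "A \<in> carrier (matrix_ring R n) \<Longrightarrow> i < n \<Longrightarrow> j < n \<Longrightarrow> A (i, j) \<in> carrier R"
  by (auto simp: matrix_carrier)

lemma matrix_eqI:
  assumes "A \<in> carrier (matrix_ring R n)" "B \<in> carrier (matrix_ring R n)"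
    and "\<And>i j. i < n \<Longrightarrow> j < n \<Longrightarrow> A (i, j) = B (i, j)"
  shows "A = B"
  using assms(1,2) unfolding matrix_carrier
  by (rule PiE_ext) (auto intro: assms(3))

lemma matrix_add_entry:
  "i < n \<Longrightarrow> j < n \<Longrightarrow> (A \<oplus>\<^bsub>matrix_ring R n\<^esub> B) (i, j) = A (i, j) \<oplus>\<^bsub>R\<^esub> B (i, j)"
  and matrix_zero_entry: "i < n \<Longrightarrow> j < n \<Longrightarrow> \<zero>\<^bsub>matrix_ring R n\<^esub> (i, j) = \<zero>\<^bsub>R\<^esub>"
  and matrix_smult_entry:
  "i < n \<Longrightarrow> j < n \<Longrightarrow> (c \<odot>\<^bsub>matrix_ring R n\<^esub> A) (i, j) = c \<otimes>\<^bsub>R\<^esub> A (i, j)"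
  by (simp_all add: matrix_ring_def)

context cring
begin

lemma matrix_smult_closed:
  "c \<in> carrier R \<Longrightarrow> A \<in> carrier (matrix_ring R n) \<Longrightarrow>
    c \<odot>\<^bsub>matrix_ring R n\<^esub> A \<in> carrier (matrix_ring R n)"
  by (auto simp: matrix_ring_def)

lemma matrix_mult_closed:
  "A \<in> carrier (matrix_ring R n) \<Longrightarrow> B \<in> carrier (matrix_ring R n) \<Longrightarrow>
    A \<otimes>\<^bsub>matrix_ring R n\<^esub> B \<in> carrier (matrix_ring R n)"
  by (auto simp: matrix_ring_def intro!: finsum_closed)

lemma matrix_one_closed: "\<one>\<^bsub>matrix_ring R n\<^esub> \<in> carrier (matrix_ring R n)"
  by (auto simp: matrix_ring_def)

lemma matrix_pow_closed:
  fixes k :: nat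
  shows "A \<in> carrier (matrix_ring R n) \<Longrightarrow>
    A [^]\<^bsub>matrix_ring R n\<^esub> k \<in> carrier (matrix_ring R n)"
  by (induction k) (auto simp: nat_pow_def intro: matrix_one_closed matrix_mult_closed)

lemma matrix_finsum_entry:
  assumes "finite I" "F \<in> I \<rightarrow> carrier (matrix_ring R n)" "i < n" "j < n"
  shows "(\<Oplus>\<^bsub>matrix_ring R n\<^esub>k\<in>I. F k) (i, j) = (\<Oplus>k\<in>I. F k (i, j))"
proof -
  interpret M: abelian_group "matrix_ring R n"
    by (rule matrix_ring_abelian_group) (rule ring_axioms)
  have "(\<lambda>k. F k (i, j)) \<in> I \<rightarrow> carrier R"
    using assms(2-4) by (auto intro: matrix_entry_closed)
  with assms show ?thesis
    by (induction I rule: finite_induct)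
      (simp_all add: matrix_zero_entry matrix_add_entry Pi_iff)
qed

section \<open>Squares of 2 by 2 matrices and sums of two squares\<close>

lemma matrix2_mult_entry:
  assumes "A \<in> carrier (matrix_ring R 2)" "B \<in> carrier (matrix_ring R 2)" "i < 2" "j < 2"
  shows "(A \<otimes>\<^bsub>matrix_ring R 2\<^esub> B) (i, j) =
    A (i, 0) \<otimes> B (0, j) \<oplus> A (i, 1) \<otimes> B (1, j)"
proof -
  have "{..<2} = {0, 1 :: nat}" by auto
  moreover have "(A \<otimes>\<^bsub>matrix_ring R 2\<^esub> B) (i, j) = (\<Oplus>k\<in>{..<2}. A (i, k) \<otimes> B (k, j))"
    using assms(3,4) by (simp add: matrix_ring_def)
  ultimately show ?thesis
    using assms by (simp add: matrix_entry_closed)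
qed

lemma matrix2_square_entry:
  assumes "A \<in> carrier (matrix_ring R 2)" "i < 2" "j < 2"
  shows "(A [^]\<^bsub>matrix_ring R 2\<^esub> (2::nat)) (i, j) =
    A (i, 0) \<otimes> A (0, j) \<oplus> A (i, 1) \<otimes> A (1, j)"
proof -
  have one: "\<one>\<^bsub>matrix_ring R 2\<^esub> (k, l) = (if k = l then \<one> else \<zero>)" if "k < 2" "l < 2" for k l
    using that by (simp add: matrix_ring_def)
  \<comment> \<open>The power with exponent 2 unfolds to the identity times \<open>A\<close> times
    \<open>A\<close>, so the left unit law is what turns it into a product of two factors.\<close>
  have "\<one>\<^bsub>matrix_ring R 2\<^esub> \<otimes>\<^bsub>matrix_ring R 2\<^esub> A = A"
  proof (rule matrix_eqI)
    show "\<one>\<^bsub>matrix_ring R 2\<^esub> \<otimes>\<^bsub>matrix_ring R 2\<^esub> A \<in> carrier (matrix_ring R 2)"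
      using assms(1) by (intro matrix_mult_closed matrix_one_closed)
    fix k l :: nat assume "k < 2" "l < 2"
    then show "(\<one>\<^bsub>matrix_ring R 2\<^esub> \<otimes>\<^bsub>matrix_ring R 2\<^esub> A) (k, l) = A (k, l)"
      using assms(1)
      by (auto simp: matrix2_mult_entry matrix_one_closed matrix_entry_closed one less_2_cases_iff)
  qed (rule assms(1))
  then have "A [^]\<^bsub>matrix_ring R 2\<^esub> (2::nat) = A \<otimes>\<^bsub>matrix_ring R 2\<^esub> A"
    by (simp add: nat_pow_def numeral_2_eq_2)
  then show ?thesis
    using assms by (simp add: matrix2_mult_entry)
qed

text \<open>
  A square of a matrix of trace \<open>1\<close> has the same off-diagonal entries as the matrix, and a
  matrix of trace \<open>0\<close> can have any scalar matrix as its square.  This leaves one linear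
  equation for the diagonal of the first matrix, solvable because \<open>2\<close> is invertible.
\<close>

lemma matrix2_two_squares:
  assumes A: "A \<in> carrier (matrix_ring R 2)"
    and u: "u \<in> Units R" and v: "v \<in> Units R" and two: "\<one> \<oplus> \<one> \<in> Units R"
  obtains X Y where "X \<in> carrier (matrix_ring R 2)" "Y \<in> carrier (matrix_ring R 2)"
    "A = u \<odot>\<^bsub>matrix_ring R 2\<^esub> (X [^]\<^bsub>matrix_ring R 2\<^esub> (2::nat)) \<oplus>\<^bsub>matrix_ring R 2\<^esub>
         v \<odot>\<^bsub>matrix_ring R 2\<^esub> (Y [^]\<^bsub>matrix_ring R 2\<^esub> (2::nat))"
proof -
  interpret M: abelian_group "matrix_ring R 2"
    by (rule matrix_ring_abelian_group) (rule ring_axioms)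
  define h where "h = inv (\<one> \<oplus> \<one>)"
  define a where "a = inv u \<otimes> A (0, 0)"
  define b where "b = inv u \<otimes> A (0, 1)"
  define c where "c = inv u \<otimes> A (1, 0)"
  define d where "d = inv u \<otimes> A (1, 1)"
  have uv [simp]: "u \<in> carrier R" "v \<in> carrier R" using u v by auto
  have iv: "inv v \<in> carrier R" "inv u \<in> carrier R" using u v by auto
  have h [simp]: "h \<in> carrier R" and hh: "(\<one> \<oplus> \<one>) \<otimes> h = \<one>"
    using two by (auto simp: h_def)
  have cl [simp]: "a \<in> carrier R" "b \<in> carrier R" "c \<in> carrier R" "d \<in> carrier R"
    using A u by (auto simp: a_def b_def c_def d_def matrix_entry_closed)
  have Au: "A (i, j) = u \<otimes> (inv u \<otimes> A (i, j))" if "i < 2" "j < 2" for i j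
    using that A u uv iv by (simp add: matrix_entry_closed m_assoc[symmetric])
  \<comment> \<open>The diagonal entries of the square of the matrix with rows (x, b) and (c, y)
    differ by x^2 - y^2. With x + y = 1 this is x - y = 2x - 1, which has to equal a - d.\<close>
  define x where "x = h \<otimes> (a \<ominus> d \<oplus> \<one>)"
  define y where "y = \<one> \<ominus> x"
  \<comment> \<open>\<open>w\<close> is the scalar by which the diagonal of A / u exceeds that of
    the first square; \<open>e\<close> rescales it so that the coefficient \<open>v\<close> can
    produce it.\<close>
  define w where "w = a \<ominus> (x \<otimes> x \<oplus> b \<otimes> c)"
  define e where "e = inv v \<otimes> (u \<otimes> w)"
  have x [simp]: "x \<in> carrier R" by (simp add: x_def)
  have y [simp]: "y \<in> carrier R" by (simp add: y_def)
  have w [simp]: "w \<in> carrier R" by (simp add: w_def)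
  have e [simp]: "e \<in> carrier R" using iv by (simp add: e_def)
  have add_diff: "r \<oplus> (s \<ominus> r) = s" if "r \<in> carrier R" "s \<in> carrier R" for r s
    using that by (simp add: a_minus_def a_lcomm[of r s] r_neg)
  have xy: "x \<oplus> y = \<one>" unfolding y_def by (simp add: add_diff)
  have aw: "x \<otimes> x \<oplus> b \<otimes> c \<oplus> w = a" unfolding w_def by (simp add: add_diff)
  have "x \<oplus> x = ((\<one> \<oplus> \<one>) \<otimes> h) \<otimes> (a \<ominus> d \<oplus> \<one>)"
    unfolding x_def by (simp add: l_distr)
  then have xx: "x \<oplus> x = a \<ominus> d \<oplus> \<one>" by (simp add: hh)
  have "x \<oplus> (d \<oplus> x) = d \<oplus> (x \<oplus> x)" by (simp add: a_ac m_ac l_distr r_distr)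
  also have "\<dots> = a \<oplus> (x \<oplus> y)" unfolding xx xy by (simp add: a_assoc[symmetric] add_diff)
  also have "\<dots> = x \<oplus> (a \<oplus> y)" by (simp add: a_ac m_ac l_distr r_distr)
  finally have dx: "d \<oplus> x = a \<oplus> y" by simp
  have ve: "v \<otimes> e = u \<otimes> w"
    using v iv by (simp add: e_def m_assoc[symmetric])
  define X where "X = (\<lambda>(i, j) \<in> {..<2::nat} \<times> {..<2::nat}.
    if i = 0 then if j = 0 then x else b else if j = 0 then c else y)"
  \<comment> \<open>Trace 0 and determinant -e, so the square is e times the identity.\<close>
  define Y where "Y = (\<lambda>(i, j) \<in> {..<2::nat} \<times> {..<2::nat}.
    if i = j then \<zero> else if i = 0 then e else \<one>)"
  have X: "X \<in> carrier (matrix_ring R 2)" and Y: "Y \<in> carrier (matrix_ring R 2)"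
    by (auto simp: X_def Y_def matrix_carrier)
  have Xe: "X (0, 0) = x" "X (0, 1) = b" "X (1, 0) = c" "X (1, 1) = y"
    and Ye: "Y (0, 0) = \<zero>" "Y (0, 1) = e" "Y (1, 0) = \<one>" "Y (1, 1) = \<zero>"
    by (simp_all add: X_def Y_def)
  have e00: "u \<otimes> a = u \<otimes> (x \<otimes> x \<oplus> b \<otimes> c) \<oplus> u \<otimes> w"
    unfolding aw[symmetric] by (simp add: r_distr)
  have "x \<otimes> b \<oplus> b \<otimes> y = b \<otimes> (x \<oplus> y)" by (simp add: a_ac m_ac l_distr r_distr)
  then have e01: "u \<otimes> b = u \<otimes> (x \<otimes> b \<oplus> b \<otimes> y)" by (simp add: xy)
  have "c \<otimes> x \<oplus> y \<otimes> c = c \<otimes> (x \<oplus> y)" by (simp add: a_ac m_ac l_distr r_distr)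
  then have e10: "u \<otimes> c = u \<otimes> (c \<otimes> x \<oplus> y \<otimes> c)" by (simp add: xy)
  \<comment> \<open>This is x^2 - y^2 = x - y, a consequence of x + y = 1, written without
    subtraction so that the commutative normalisation applies.\<close>
  have "x \<otimes> x \<oplus> y = x \<otimes> x \<oplus> (x \<oplus> y) \<otimes> y" by (simp add: xy)
  also have "\<dots> = x \<otimes> (x \<oplus> y) \<oplus> y \<otimes> y" by (simp add: a_ac m_ac l_distr r_distr)
  also have "\<dots> = x \<oplus> y \<otimes> y" by (simp add: xy)
  finally have xyy: "x \<otimes> x \<oplus> y = x \<oplus> y \<otimes> y" .
  \<comment> \<open>The lower right entry is computed with x added to both sides, so that
    \<open>dx\<close> and \<open>xyy\<close> can be used; x is cancelled at the end.\<close>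
  have "x \<oplus> d = (x \<otimes> x \<oplus> b \<otimes> c \<oplus> w) \<oplus> y"
    unfolding aw dx[symmetric] by (simp add: a_ac m_ac l_distr r_distr)
  also have "\<dots> = (x \<otimes> x \<oplus> y) \<oplus> (c \<otimes> b \<oplus> w)" by (simp add: a_ac m_ac l_distr r_distr)
  also have "\<dots> = x \<oplus> (c \<otimes> b \<oplus> y \<otimes> y \<oplus> w)" unfolding xyy by (simp add: a_ac m_ac l_distr r_distr)
  finally have "d = c \<otimes> b \<oplus> y \<otimes> y \<oplus> w" by simp
  then have e11: "u \<otimes> d = u \<otimes> (c \<otimes> b \<oplus> y \<otimes> y) \<oplus> u \<otimes> w"
    by (simp add: r_distr)
  have "A = u \<odot>\<^bsub>matrix_ring R 2\<^esub> (X [^]\<^bsub>matrix_ring R 2\<^esub> (2::nat)) \<oplus>\<^bsub>matrix_ring R 2\<^esub>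
         v \<odot>\<^bsub>matrix_ring R 2\<^esub> (Y [^]\<^bsub>matrix_ring R 2\<^esub> (2::nat))" (is "_ = ?B")
  proof (rule matrix_eqI)
    show "?B \<in> carrier (matrix_ring R 2)"
      using X Y by (intro M.add.m_closed matrix_smult_closed matrix_pow_closed) auto
    fix i j :: nat assume ij: "i < 2" "j < 2"
    have B: "?B (i, j) = u \<otimes> (X (i, 0) \<otimes> X (0, j) \<oplus> X (i, 1) \<otimes> X (1, j)) \<oplus>
        v \<otimes> (Y (i, 0) \<otimes> Y (0, j) \<oplus> Y (i, 1) \<otimes> Y (1, j))"
      using X Y ij by (simp add: matrix_add_entry matrix_smult_entry matrix2_square_entry)
    consider "i = 0" "j = 0" | "i = 0" "j = 1" | "i = 1" "j = 0" | "i = 1" "j = 1"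
      using ij by (auto simp: less_2_cases_iff)
    then show "A (i, j) = ?B (i, j)"
    proof cases
      case 1
      have "A (0, 0) = u \<otimes> a" unfolding a_def by (rule Au) simp_all
      then show ?thesis unfolding 1 B[unfolded 1 Xe Ye] by (simp add: ve e00[symmetric])
    next
      case 2
      have "A (0, 1) = u \<otimes> b" unfolding b_def by (rule Au) simp_all
      then show ?thesis unfolding 2 B[unfolded 2 Xe Ye] by (simp add: ve e01[symmetric])
    next
      case 3
      have "A (1, 0) = u \<otimes> c" unfolding c_def by (rule Au) simp_all
      then show ?thesis unfolding 3 B[unfolded 3 Xe Ye] by (simp add: ve e10[symmetric])
    next
      case 4
      have "A (1, 1) = u \<otimes> d" unfolding d_def by (rule Au) simp_all
      then show ?thesis unfolding 4 B[unfolded 4 Xe Ye] by (simp add: ve e11[symmetric])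
    qed
  qed (rule A)
  with X Y show ?thesis using that by blast
qed

text \<open>The two terms with unit coefficients already represent any given matrix, so all other
  variables are set to the zero matrix.\<close>

lemma universal_over_matrices2I:
  assumes a: "\<And>k. k \<in> {1..m} \<Longrightarrow> a k \<in> carrier R"
    and two: "\<one> \<oplus> \<one> \<in> Units R"
    and ij: "i \<in> {1..m}" "j \<in> {1..m}" "i \<noteq> j" "a i \<in> Units R" "a j \<in> Units R"
  shows "universal_over_matrices R 2 m a"
  unfolding universal_over_matrices_def
proof
  interpret M: abelian_group "matrix_ring R 2"
    by (rule matrix_ring_abelian_group) (rule ring_axioms)
  fix A assume A: "A \<in> carrier (matrix_ring R 2)"
  obtain P Q where P: "P \<in> carrier (matrix_ring R 2)" and Q: "Q \<in> carrier (matrix_ring R 2)"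
    and AB: "A = a i \<odot>\<^bsub>matrix_ring R 2\<^esub> (P [^]\<^bsub>matrix_ring R 2\<^esub> (2::nat)) \<oplus>\<^bsub>matrix_ring R 2\<^esub>
         a j \<odot>\<^bsub>matrix_ring R 2\<^esub> (Q [^]\<^bsub>matrix_ring R 2\<^esub> (2::nat))"
    using matrix2_two_squares[OF A ij(4,5) two] .
  define X where "X k = (if k = i then P else if k = j then Q else \<zero>\<^bsub>matrix_ring R 2\<^esub>)" for k
  define F where "F k = a k \<odot>\<^bsub>matrix_ring R 2\<^esub> (X k [^]\<^bsub>matrix_ring R 2\<^esub> (2::nat))" for k
  have X: "X \<in> {1..m} \<rightarrow> carrier (matrix_ring R 2)" using P Q by (auto simp: X_def)
  have F: "F \<in> {1..m} \<rightarrow> carrier (matrix_ring R 2)"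
    unfolding F_def using X a by (auto intro!: matrix_smult_closed matrix_pow_closed)
  have F0: "F k = \<zero>\<^bsub>matrix_ring R 2\<^esub>" if "k \<in> {1..m} - {i, j}" for k
  proof (rule matrix_eqI)
    fix r s :: nat assume "r < 2" "s < 2"
    then show "F k (r, s) = \<zero>\<^bsub>matrix_ring R 2\<^esub> (r, s)"
      using that a by (simp add: F_def X_def matrix_smult_entry matrix2_square_entry
          matrix_zero_entry)
  qed (use F that in auto)
  have "(\<Oplus>\<^bsub>matrix_ring R 2\<^esub>k\<in>{1..m}. F k) = (\<Oplus>\<^bsub>matrix_ring R 2\<^esub>k\<in>{i, j}. F k)"
    using F F0 ij by (intro M.add.finprod_mono_neutral_cong_right) auto
  also have "\<dots> = F i \<oplus>\<^bsub>matrix_ring R 2\<^esub> F j"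
    using F ij by (simp add: Pi_iff)
  also have "\<dots> = A" using ij(3) by (simp add: F_def X_def AB)
  finally show "\<exists>X \<in> {1..m} \<rightarrow> carrier (matrix_ring R 2).
      A = (\<Oplus>\<^bsub>matrix_ring R 2\<^esub>k\<in>{1..m}.
             a k \<odot>\<^bsub>matrix_ring R 2\<^esub> (X k [^]\<^bsub>matrix_ring R 2\<^esub> (2::nat)))"
    using X unfolding F_def by (intro bexI[of _ X]) auto
qed

end

section \<open>The obstruction modulo p and the equivalence\<close>

text \<open>The off-diagonal entries of X^2 are those of X times the trace. The upper right entry
  being 1 modulo p makes \<open>c\<close> and the trace x + w invertible, so the lower left entry
  forces p to divide \<open>z\<close>. The diagonal then forces p to divide x and w, hence the
  trace.\<close>

lemma scaled_square_not_nilpotent_mod_prime: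
  fixes p c x y z w :: int
  assumes "prime p"
    and e: "p dvd c * (x * x + y * z)" "p dvd c * (z * x + w * z)" "p dvd c * (z * y + w * w)"
    and "[c * (x * y + y * w) = 1] (mod p)"
  shows False
proof -
  have n: "\<not> p dvd c * (x * y + y * w)"
    using assms(1,5) cong_dvd_iff not_prime_unit by blast
  moreover have "c * (x * y + y * w) = c * y * (x + w)" by (simp add: algebra_simps)
  ultimately have c: "\<not> p dvd c" and t: "\<not> p dvd x + w" by auto
  have "c * (z * x + w * z) = c * (z * (x + w))" by (simp add: algebra_simps)
  with e(2) c have "p dvd z * (x + w)"
    using assms(1) by (metis prime_dvd_mult_iff)
  then have z: "p dvd z" using t assms(1) by (simp add: prime_dvd_mult_iff)
  have "p dvd x * x" "p dvd w * w"
    using e(1,3) c z assms(1) by (simp_all add: prime_dvd_mult_iff dvd_add_left_iff dvd_add_right_iff)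
  then have "p dvd x + w" using assms(1) by (simp add: prime_dvd_mult_iff)
  with t show False by simp
qed

theorem theorem2p3:
  fixes p m :: nat and a :: "nat \<Rightarrow> nat \<Rightarrow> int"
  assumes "prime p" and "odd p" and "m \<ge> 1"
    and "\<And>i. i \<in> {1..m} \<Longrightarrow> a i \<in> carrier (padic_int_ring p)"
  shows "universal_over_matrices (padic_int_ring p) 2 m a \<longleftrightarrow>
    card {i \<in> {1..m}. a i \<in> Units (padic_int_ring p)} \<ge> 2"
    (is "?univ \<longleftrightarrow> card ?U \<ge> 2")
proof
  have p2: "p > 2" using assms(1,2) prime_ge_2_nat[of p] by (cases "p = 2") auto
  interpret Z: cring "padic_int_ring p" using p2 by (intro padic_int_cring) simp
  let ?M = "matrix_ring (padic_int_ring p) 2"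
  {
    assume "card ?U \<ge> 2"
    then obtain i j where "i \<in> ?U" "j \<in> ?U" "i \<noteq> j"
      by (auto simp: numeral_2_eq_2 card_le_Suc_iff)
    \<comment> \<open>The residue of 1 + 1 modulo p is 2, which is nonzero since p > 2.\<close>
    moreover have "\<one>\<^bsub>padic_int_ring p\<^esub> \<oplus>\<^bsub>padic_int_ring p\<^esub> \<one>\<^bsub>padic_int_ring p\<^esub>
        \<in> Units (padic_int_ring p)"
      using p2 by (intro padic_UnitsI assms(1) Z.a_closed Z.one_closed)
        (simp_all add: padic_add padic_one)
    ultimately show ?univ using assms(4) by (intro Z.universal_over_matrices2I[of m a i j]) auto
  next
    assume univ: ?univ
    show "card ?U \<ge> 2"
    proof (rule ccontr)
      assume "\<not> card ?U \<ge> 2"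
      then have "card ?U \<le> Suc 0" by simp
      then have U1: "\<And>i j. i \<in> ?U \<Longrightarrow> j \<in> ?U \<Longrightarrow> i = j"
        by (simp add: card_le_Suc0_iff_eq)
      \<comment> \<open>If no coefficient is a unit, any index serves as \<open>k\<close>, and 1 is
        available because m is positive; the obstruction holds for every residue of
        \<open>a k\<close>, including 0.\<close>
      obtain k where k: "k \<in> {1..m}" "?U \<subseteq> {k}"
      proof (cases "?U = {}")
        case True
        then show ?thesis using assms(3) that[of 1] by auto
      next
        case False
        then show ?thesis using U1 that by blast
      qed
      have a0: "a i 1 = 0" if "i \<in> {1..m} - {k}" for i
        using padic_UnitsI[OF assms(1) assms(4)] k(2) that by blast
      \<comment> \<open>The matrix that is not represented: nonzero and nilpotent, also after
        reduction modulo p.\<close>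
      define N where "N = (\<lambda>(i, j) \<in> {..<2::nat} \<times> {..<2::nat}.
        if i = 0 \<and> j = 1 then \<one>\<^bsub>padic_int_ring p\<^esub> else \<zero>\<^bsub>padic_int_ring p\<^esub>)"
      have "N \<in> carrier ?M" by (auto simp: N_def matrix_carrier)
      with univ obtain X where X: "X \<in> {1..m} \<rightarrow> carrier ?M"
        and N: "N = (\<Oplus>\<^bsub>?M\<^esub>i\<in>{1..m}. a i \<odot>\<^bsub>?M\<^esub> (X i [^]\<^bsub>?M\<^esub> (2::nat)))"
        unfolding universal_over_matrices_def by blast
      let ?x = "\<lambda>r s. X k (r, s) 1"
      \<comment> \<open>Read at level 1, that is modulo p, the sum keeps only the term with index
        \<open>k\<close>, since all other coefficients have residue 0.\<close>
      have eq: "[N (r, s) 1 = a k 1 * (?x r 0 * ?x 0 s + ?x r 1 * ?x 1 s)] (mod int p)"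
        if rs: "r < 2" "s < 2" for r s
      proof -
        define f where "f i = (a i \<odot>\<^bsub>?M\<^esub> (X i [^]\<^bsub>?M\<^esub> (2::nat))) (r, s)" for i
        have cl: "(\<lambda>i. a i \<odot>\<^bsub>?M\<^esub> (X i [^]\<^bsub>?M\<^esub> (2::nat))) \<in> {1..m} \<rightarrow> carrier ?M"
          using X assms(4) by (auto intro!: Z.matrix_smult_closed Z.matrix_pow_closed)
        have fcl: "f \<in> {1..m} \<rightarrow> carrier (padic_int_ring p)"
          unfolding f_def using cl rs by (blast intro: matrix_entry_closed)
        have f: "f i 1 = a i 1 * (X i (r, 0) 1 * X i (0, s) 1 + X i (r, 1) 1 * X i (1, s) 1)
            mod int p" if "i \<in> {1..m}" for i
        proof -
          have "X i \<in> carrier ?M" using X that by blast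
          from Z.matrix2_square_entry[OF this rs] show ?thesis
            using rs by (simp add: f_def matrix_smult_entry padic_mult padic_add mod_simps)
        qed
        have "N (r, s) = (\<Oplus>\<^bsub>padic_int_ring p\<^esub>i\<in>{1..m}. f i)"
          unfolding N f_def using cl rs by (intro Z.matrix_finsum_entry) auto
        then have "N (r, s) 1 = (\<Sum>i\<in>{1..m}. f i 1) mod int p"
          using padic_finsum[of p "{1..m}" f 1] fcl p2 by simp
        also have "(\<Sum>i\<in>{1..m}. f i 1) = f k 1"
          using k(1) f a0 by (subst sum.remove[of _ k]) simp_all
        finally show ?thesis using f[OF k(1)] by (simp add: cong_def)
      qed
      have "prime (int p)" using assms(1) by simp
      moreover have "N (0, 0) 1 = 0" "N (1, 0) 1 = 0" "N (1, 1) 1 = 0" "N (0, 1) 1 = 1"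
        using p2 by (simp_all add: N_def padic_zero padic_one)
      ultimately show False
        using eq[of 0 0] eq[of 0 1] eq[of 1 0] eq[of 1 1]
        by (intro scaled_square_not_nilpotent_mod_prime
              [of "int p" "a k 1" "?x 0 0" "?x 0 1" "?x 1 0" "?x 1 1"])
          (simp_all add: cong_0_iff cong_sym_eq[of 0] cong_sym_eq[of 1])
    qed
  }
qed

end
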